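(* Let $f=\sum_{i=0}^dc_ix^i\in\mathbb{R}[x]$ be a univariate polynomial of even degree $d$ with positive constant coefficient. Put $$\hat f:=c_0-\sum_{i=1}^{d-1}|c_i|x^i+c_dx^d$$ and let $x_0:=\inf\{x\in\mathbb{R}_+ : \hat f(x)<0\}$. (1) If $x_0=+\infty$ (i.e., if $\hat f(x)\ge0$ for all $x\in\mathbb{R}$), then $f$ is a SONC polynomial. (2) Otherwise, there exists a sequence $(p_N)_N\subseteq\mathbb{R}[x]$ of SONC polynomials which converges to $f$ uniformly on every compact subset of the open interval $(-x_0,x_0)$.
   Context: $\mathbb{R}_+=[0,\infty)$ and $\inf\emptyset=+\infty$. A univariate polynomial $p\in\mathbb{R}[x]$ is a SONC polynomial if it is a finite sum of polynomials, each non-negative on $\mathbb{R}$ and each of one of the following two types: (i) $\sum_{i\text{ even}}c_ix^i$ (finite sum over even $i\ge0$) with at most one negative coefficient $c_i$; (ii) $\sum_{i\text{ even}}c_ix^i+d\,x^j$ with all $c_i\ge0$, $j$ an odd natural number and $d\in\mathbb{R}$. (Equivalently, in the paper's notation, $p$ lies for some $r\in\mathbb{N}$ in the cone $C_{\mathcal{S}}(\{0,\dots,r\}\cap2\mathbb{N},\{0,\dots,r\}\setminus2\mathbb{N})$ of sums of non-negative AG functions of types (i), (ii) of degree at most $r$.) *)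

theory Defs
  imports "HOL-Analysis.Analysis" "HOL-Computational_Algebra.Polynomial"
begin

definition nonneg_poly :: "real poly \<Rightarrow> bool" where
  "nonneg_poly p \<longleftrightarrow> (\<forall>x. poly p x \<ge> 0)"

definition even_poly :: "real poly \<Rightarrow> bool" where
  "even_poly p \<longleftrightarrow> (\<forall>i. odd i \<longrightarrow> coeff p i = 0)"

definition AG_even :: "real poly \<Rightarrow> bool" where
  "AG_even p \<longleftrightarrow> even_poly p \<and> card {i. coeff p i < 0} \<le> 1"

definition AG_odd :: "real poly \<Rightarrow> bool" where
  "AG_odd p \<longleftrightarrow>
     (\<exists>g j d. even_poly g \<and> (\<forall>i. coeff g i \<ge> 0) \<and> odd j \<and> p = g + monom d j)"

(* The empty sum is allowed; it yields 0, which is itself of the first type. *)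
definition SONC :: "real poly \<Rightarrow> bool" where
  "SONC p \<longleftrightarrow>
     (\<exists>qs. (\<forall>q\<in>set qs. nonneg_poly q \<and> (AG_even q \<or> AG_odd q)) \<and> p = sum_list qs)"

(* For a constant polynomial the literal formula counts the constant coefficient twice;
   this affects neither the sign nor the location of the zeros. *)
definition hat_poly :: "real poly \<Rightarrow> real poly" where
  "hat_poly f =
     [:coeff f 0:] - (\<Sum>i\<in>{1..<degree f}. monom \<bar>coeff f i\<bar> i)
       + monom (coeff f (degree f)) (degree f)"

(* The infimum is taken in the extended reals, so that it is infinity for the empty set. *)
definition first_neg :: "real poly \<Rightarrow> ereal" where
  "first_neg p = Inf (ereal ` {x. 0 \<le> x \<and> poly p x < 0})"

end

theory Submission
  imports Defs
begin

text \<open>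
  For \<open>f\<close> of positive degree write \<open>f = c0 + q + P\<close>, where \<open>P\<close> is the leading term if its
  coefficient is positive and \<open>0\<close> otherwise, and let \<open>|q|\<close> be \<open>q\<close> with its coefficients replaced by their absolute values, so that
  \<open>c0 - |q| + P\<close> is the polynomial whose first negative point is \<open>x0\<close>. The core is
  \<open>SONC_inner_terms\<close>: for any even \<open>P\<close> with nonnegative coefficients that lives in degrees above
  those of \<open>q\<close>, if \<open>c0 - |q| + P \<ge> 0\<close> on the half-line, then \<open>c0 + q + P\<close> is SONC.

  If \<open>q = 0\<close> all coefficients are nonnegative. Otherwise the decomposition has one summand \<open>\<alpha>\<^sub>i + q\<^sub>i x\<^sup>i + \<beta>\<^sub>i P\<close> for each nonzero coefficient \<open>q\<^sub>i\<close>. In the variable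
  \<open>x\<^sup>i\<close> the function \<open>P\<close> is convex on the half-line, so for any given point \<open>s > 0\<close> there are weights
  \<open>\<alpha>\<^sub>i, \<beta>\<^sub>i \<ge> 0\<close> for which \<open>\<alpha>\<^sub>i - |q\<^sub>i| x\<^sup>i + \<beta>\<^sub>i P\<close> is nonnegative with a double zero at \<open>s\<close>. The
  same point \<open>s\<close> serves all \<open>i\<close>, and the intermediate value theorem yields one at which the \<open>\<alpha>\<^sub>i\<close> add
  up to exactly \<open>c0\<close>. Adding the equations at \<open>s\<close> gives \<open>c0 - |q|(s) + (\<Sum>\<beta>\<^sub>i) P(s) = 0\<close>, and comparing
  this with the hypothesis at \<open>s\<close> gives \<open>\<Sum>\<beta>\<^sub>i \<le> 1\<close>; what is left of \<open>P\<close> is again SONC.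

  If \<open>x0\<close> is infinite, this applies to \<open>f\<close> itself. Otherwise it applies to \<open>f + C (x / x0)\<^bsup>2(N+d)\<^esup>\<close>
  with \<open>d\<close> the degree of \<open>f\<close>: below \<open>x0\<close> nothing needs repair, and beyond \<open>x0\<close> a polynomial of
  degree \<open>d\<close> is dominated by \<open>C (x / x0)\<^sup>d\<close> for a suitable \<open>C\<close> (\<open>abs_poly_growth\<close>). The added term tends
  to \<open>0\<close> uniformly on compact subsets of \<open>(-x0, x0)\<close>.
\<close>

section \<open>The cone of SONC polynomials\<close>

lemma SONC_0: "SONC 0"
  unfolding SONC_def by (rule exI[of _ "[]"]) simp

lemma SONC_single:
  assumes "nonneg_poly p" "AG_even p \<or> AG_odd p"
  shows "SONC p"
  unfolding SONC_def using assms by (intro exI[of _ "[p]"]) simp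

lemma SONC_add:
  assumes "SONC p" "SONC q"
  shows "SONC (p + q)"
proof -
  obtain ps qs where
    "\<forall>r\<in>set ps. nonneg_poly r \<and> (AG_even r \<or> AG_odd r)" "p = sum_list ps"
    "\<forall>r\<in>set qs. nonneg_poly r \<and> (AG_even r \<or> AG_odd r)" "q = sum_list qs"
    using assms unfolding SONC_def by blast
  then show ?thesis
    unfolding SONC_def by (intro exI[of _ "ps @ qs"]) auto
qed

lemma SONC_sum:
  assumes "\<And>i. i \<in> A \<Longrightarrow> SONC (g i)"
  shows "SONC (\<Sum>i\<in>A. g i)"
  using assms by (induction A rule: infinite_finite_induct) (auto intro: SONC_0 SONC_add)

lemma poly_abs_even_poly:
  assumes "even_poly p"
  shows "poly p \<bar>x\<bar> = poly p x"
  unfolding poly_altdef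
proof (rule sum.cong[OF refl])
  fix i
  show "coeff p i * \<bar>x\<bar> ^ i = coeff p i * x ^ i"
    using assms by (cases "even i") (auto simp: even_poly_def power_even_abs)
qed

lemma poly_nonneg_coeffs:
  fixes p :: "real poly"
  assumes "\<And>i. coeff p i \<ge> 0" "x \<ge> 0"
  shows "poly p x \<ge> 0"
  unfolding poly_altdef using assms by (intro sum_nonneg mult_nonneg_nonneg) auto

lemma SONC_even_nonneg_coeffs:
  assumes "even_poly p" "\<And>i. coeff p i \<ge> 0"
  shows "SONC p"
proof (rule SONC_single)
  show "nonneg_poly p"
    unfolding nonneg_poly_def
    using poly_nonneg_coeffs[OF assms(2)] poly_abs_even_poly[OF assms(1)]
    by (metis abs_ge_zero)
  have "{i. coeff p i < 0} = {}"
    using assms(2) by (auto simp: not_less)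
  then show "AG_even p \<or> AG_odd p"
    using assms(1) by (simp add: AG_even_def)
qed

section \<open>Coefficientwise absolute values\<close>

definition abs_poly :: "real poly \<Rightarrow> real poly" where
  "abs_poly p = map_poly abs p"

lemma coeff_abs_poly [simp]: "coeff (abs_poly p) i = \<bar>coeff p i\<bar>"
  by (simp add: abs_poly_def coeff_map_poly)

lemma degree_abs_poly [simp]: "degree (abs_poly p) = degree p"
  unfolding abs_poly_def by (rule degree_map_poly) auto

lemma abs_poly_nonneg: "x \<ge> 0 \<Longrightarrow> poly (abs_poly p) x \<ge> 0"
  by (rule poly_nonneg_coeffs) auto

lemma abs_poly_bound: "\<bar>poly p x\<bar> \<le> poly (abs_poly p) \<bar>x\<bar>"
proof -
  have "\<bar>poly p x\<bar> \<le> (\<Sum>i\<le>degree p. \<bar>coeff p i * x ^ i\<bar>)"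
    unfolding poly_altdef by (rule sum_abs)
  then show ?thesis
    by (simp add: poly_altdef abs_mult power_abs)
qed

text \<open>
  This supplies the right end of the interval for the intermediate value theorem, and it also
  rules out that nonzero inner terms are compensated by a constant alone.
\<close>
lemma abs_poly_unbounded:
  assumes "q \<noteq> 0" "coeff q 0 = 0"
  shows "\<exists>x>0. poly (abs_poly q) x \<ge> B"
proof -
  define n where "n = degree q"
  define l where "l = \<bar>lead_coeff q\<bar>"
  have l: "l > 0" using assms(1) by (simp add: l_def)
  have n: "n > 0"
    using assms by (metis n_def gr0I leading_coeff_0_iff)
  define x where "x = max 1 (B / l)"
  have x: "x \<ge> 1" "B / l \<le> x" by (auto simp: x_def)
  have "B \<le> l * x" using x l by (simp add: field_simps)
  also have "\<dots> \<le> l * x ^ n"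
    using x l n by (intro mult_left_mono self_le_power) auto
  also have "\<dots> = \<bar>coeff q n\<bar> * x ^ n" by (simp add: l_def n_def)
  also have "\<dots> \<le> (\<Sum>i\<le>degree q. \<bar>coeff q i\<bar> * x ^ i)"
    using x by (intro member_le_sum) (auto simp: n_def)
  also have "\<dots> = poly (abs_poly q) x" by (simp add: poly_altdef)
  finally show ?thesis using x by (intro exI[of _ x]) auto
qed

section \<open>Tangent inequalities\<close>

text \<open>
  The operator \<open>x d/dx\<close>. It has the monomials as eigenvectors, which makes it more convenient
  than the derivative for expressing tangency at a point \<open>s > 0\<close>.
\<close>
definition euler :: "real poly \<Rightarrow> real poly" where
  "euler p = pCons 0 (pderiv p)"

lemma coeff_euler [simp]: "coeff (euler p) i = real i * coeff p i"
  by (cases i) (auto simp: euler_def coeff_pderiv)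

lemma poly_euler: "poly (euler p) x = (\<Sum>i\<le>degree p. real i * coeff p i * x ^ i)"
  unfolding poly_altdef
proof (rule sum.mono_neutral_cong_left)
  have "degree (euler p) \<le> degree p"
    by (rule degree_le) (simp add: coeff_eq_0)
  then show "{..degree (euler p)} \<subseteq> {..degree p}" by simp
  have "real i * coeff p i = 0" if "i > degree (euler p)" for i
    using coeff_eq_0[OF that] by simp
  then show "\<forall>i\<in>{..degree p} - {..degree (euler p)}. real i * coeff p i * x ^ i = 0"
    by simp
qed simp_all

text \<open>
  Bernoulli's inequality for the exponent \<open>k / i \<ge> 1\<close>, cleared of denominators: \<open>y\<^sup>k\<close> is a convex
  function of \<open>y\<^sup>i\<close> and lies above its tangent at \<open>y = 1\<close>. In the induction on \<open>k\<close> the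
  increment of the difference of both sides is \<open>(y - 1) (\<Sum>j<i. y\<^sup>k - y\<^sup>j)\<close>, where both factors
  change sign at \<open>y = 1\<close>.
\<close>
lemma power_tangent:
  fixes y :: real
  assumes "y \<ge> 0" "i \<le> k"
  shows "real i * y ^ k \<ge> real i + real k * (y ^ i - 1)"
  using assms(2)
proof (induction k rule: dec_induct)
  case base
  then show ?case by (simp add: algebra_simps)
next
  case (step k)
  have "y ^ i - 1 = (y - 1) * (\<Sum>j<i. y ^ j)"
    by (simp add: power_diff_1_eq)
  also have "\<dots> = (\<Sum>j<i. (y - 1) * y ^ j)"
    by (simp add: sum_distrib_left)
  also have "\<dots> \<le> (\<Sum>j<i. (y - 1) * y ^ k)"
  proof (rule sum_mono)
    fix j assume "j \<in> {..<i}"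
    then have j: "j \<le> k" using step by auto
    show "(y - 1) * y ^ j \<le> (y - 1) * y ^ k"
    proof (cases "y \<ge> 1")
      case True
      then show ?thesis using j by (intro mult_left_mono power_increasing) auto
    next
      case False
      then show ?thesis using j assms(1)
        by (intro mult_left_mono_neg power_decreasing) auto
    qed
  qed
  also have "\<dots> = real i * (y ^ Suc k - y ^ k)"
    by (simp add: algebra_simps)
  finally show ?case using step.IH by (simp add: algebra_simps)
qed

text \<open>
  Summing over the monomials of \<open>P\<close>, all of degree at least \<open>i\<close>, shows that \<open>P\<close> as a function
  of \<open>x\<^sup>i\<close> lies above its tangent at \<open>x = s\<close>. The points of the half-line are written as \<open>s y\<close>.
\<close>
lemma poly_tangent:
  fixes P :: "real poly"
  assumes "\<And>k. coeff P k \<ge> 0" "\<And>k. coeff P k \<noteq> 0 \<Longrightarrow> i \<le> k" "s \<ge> 0" "y \<ge> 0"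
  shows "real i * poly P (s * y) \<ge> real i * poly P s + (y ^ i - 1) * poly (euler P) s"
proof -
  have "real i * poly P s + (y ^ i - 1) * poly (euler P) s =
      (\<Sum>k\<le>degree P. coeff P k * s ^ k * (real i + real k * (y ^ i - 1)))"
    unfolding poly_euler poly_altdef[of P] sum_distrib_left sum.distrib[symmetric]
    by (simp add: algebra_simps)
  also have "\<dots> \<le> (\<Sum>k\<le>degree P. coeff P k * s ^ k * (real i * y ^ k))"
  proof (rule sum_mono)
    fix k
    show "coeff P k * s ^ k * (real i + real k * (y ^ i - 1)) \<le> coeff P k * s ^ k * (real i * y ^ k)"
    proof (cases "coeff P k = 0")
      case False
      then show ?thesis
        using assms power_tangent[of y i k] by (intro mult_left_mono) auto
    qed simp
  qed
  also have "\<dots> = real i * poly P (s * y)"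
    by (simp add: poly_altdef sum_distrib_left algebra_simps power_mult_distrib)
  finally show ?thesis .
qed

section \<open>Decomposition into nonnegative circuit-like summands\<close>

text \<open>
  Nonnegativity need only be tested on the half-line and against the worst sign of the single
  free term. Which of the two types of summand arises depends on the parity of \<open>i\<close>.
\<close>
lemma SONC_piece:
  assumes P: "even_poly P" "\<And>k. coeff P k \<ge> 0"
    and ab: "\<alpha> \<ge> 0" "\<beta> \<ge> 0"
    and nonneg: "\<And>x. x \<ge> 0 \<Longrightarrow> \<alpha> - \<bar>b\<bar> * x ^ i + \<beta> * poly P x \<ge> 0"
  shows "SONC ([:\<alpha>:] + monom b i + smult \<beta> P)"
proof (rule SONC_single)
  define g where "g = [:\<alpha>:] + smult \<beta> P"
  have eq: "[:\<alpha>:] + monom b i + smult \<beta> P = g + monom b i"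
    by (simp add: g_def)
  have g_even: "even_poly g"
    using P(1) by (auto simp: g_def even_poly_def coeff_pCons split: nat.splits)
  have g_coeff: "coeff g k \<ge> 0" for k
    using ab P(2) by (auto simp: g_def coeff_pCons split: nat.splits)
  show "nonneg_poly ([:\<alpha>:] + monom b i + smult \<beta> P)"
    unfolding nonneg_poly_def
  proof
    fix x
    have "b * x ^ i \<ge> - (\<bar>b\<bar> * \<bar>x\<bar> ^ i)"
      by (metis abs_ge_minus_self abs_mult minus_le_iff power_abs)
    then show "poly ([:\<alpha>:] + monom b i + smult \<beta> P) x \<ge> 0"
      using nonneg[of "\<bar>x\<bar>"] by (simp add: poly_monom poly_abs_even_poly[OF P(1)])
  qed
  show "AG_even ([:\<alpha>:] + monom b i + smult \<beta> P) \<or> AG_odd ([:\<alpha>:] + monom b i + smult \<beta> P)"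
  proof (cases "even i")
    case True
    have "{k. coeff (g + monom b i) k < 0} \<subseteq> {i}"
      using g_coeff by (auto split: if_splits simp: not_less[symmetric])
    then have "card {k. coeff (g + monom b i) k < 0} \<le> 1"
      using card_mono[of "{i}" "{k. coeff (g + monom b i) k < 0}"] by simp
    moreover have "even_poly (g + monom b i)"
      using g_even True by (auto simp: even_poly_def)
    ultimately show ?thesis unfolding eq by (simp add: AG_even_def)
  next
    case False
    then show ?thesis unfolding eq AG_odd_def using g_even g_coeff by blast
  qed
qed

text \<open>
  Allowing several monomials in \<open>P\<close> matters: the approximants of \<open>f\<close> have both the leading term of
  \<open>f\<close> and a further term of high degree available to compensate the inner terms.
\<close>
lemma SONC_inner_terms:
  fixes P q :: "real poly"
  assumes c0: "c0 > 0"
    and P: "even_poly P" "\<And>k. coeff P k \<ge> 0" "\<And>k. coeff P k \<noteq> 0 \<Longrightarrow> m \<le> k"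
    and q: "coeff q 0 = 0" "\<And>i. coeff q i \<noteq> 0 \<Longrightarrow> i < m"
    and nonneg: "\<And>x. x \<ge> 0 \<Longrightarrow> c0 - poly (abs_poly q) x + poly P x \<ge> 0"
  shows "SONC ([:c0:] + q + P)"
proof (cases "q = 0")
  case True
  then show ?thesis
    using P c0
    by (intro SONC_even_nonneg_coeffs)
       (auto simp: even_poly_def coeff_pCons split: nat.splits)
next
  case q_nz: False
  have m: "m > 0"
    using q(2)[of "degree q"] q_nz by auto
  have "P \<noteq> 0"
  proof
    assume "P = 0"
    moreover obtain x where "x > 0" "poly (abs_poly q) x \<ge> c0 + 1"
      using abs_poly_unbounded[OF q_nz q(1)] by blast
    ultimately show False using nonneg[of x] by simp
  qed
  \<comment> \<open>With these abbreviations, tangency at \<open>s\<close> forces the weights to add up to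
    \<open>\<Sum>\<beta>\<^sub>i = T s / Q s\<close> and \<open>\<Sum>\<alpha>\<^sub>i = S s - T s * p s / Q s\<close>.\<close>
  define S where "S = poly (abs_poly q)"
  define T where "T = poly (euler (abs_poly q))"
  define p where "p = poly P"
  define Q where "Q = poly (euler P)"
  have p_pos: "p x > 0" if "x > 0" for x
  proof -
    have "0 < coeff P (degree P) * x ^ degree P"
      using P(2)[of "degree P"] \<open>P \<noteq> 0\<close> that
      by (intro mult_pos_pos) (metis leading_coeff_0_iff order_le_less, simp)
    also have "\<dots> \<le> p x"
      unfolding p_def poly_altdef using that P(2) by (intro member_le_sum) auto
    finally show ?thesis .
  qed
  have Q_ge: "Q x \<ge> real m * p x" if "x \<ge> 0" for x
    unfolding Q_def p_def poly_euler poly_altdef[of P] sum_distrib_left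
  proof (rule sum_mono)
    fix k
    show "real m * (coeff P k * x ^ k) \<le> real k * coeff P k * x ^ k"
      using P(2)[of k] P(3)[of k] that
      by (cases "coeff P k = 0") (auto intro!: mult_right_mono)
  qed
  have Q_pos: "Q x > 0" if "x > 0" for x
  proof -
    have "0 < real m * p x" using p_pos[OF that] m by simp
    also have "\<dots> \<le> Q x" using that by (intro Q_ge) simp
    finally show ?thesis .
  qed
  have T_nonneg: "T x \<ge> 0" if "x \<ge> 0" for x
    unfolding T_def using that by (intro poly_nonneg_coeffs) auto
  have T_le: "T x \<le> (real m - 1) * S x" if "x \<ge> 0" for x
    unfolding T_def S_def poly_euler poly_altdef[of "abs_poly q"] sum_distrib_left
  proof (simp, rule sum_mono)
    fix i
    show "real i * \<bar>coeff q i\<bar> * x ^ i \<le> (real m - 1) * (\<bar>coeff q i\<bar> * x ^ i)"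
      using q(2)[of i] that
      by (cases "coeff q i = 0") (auto intro!: mult_right_mono)
  qed
  obtain M where M: "M > 0" "S M \<ge> real m * c0"
    using abs_poly_unbounded[OF q_nz q(1)] unfolding S_def by blast
  have S_0: "S 0 = 0" by (simp add: S_def poly_0_coeff_0 q(1))
  have "c0 \<le> real m * c0" using m c0 by simp
  then have "c0 \<le> S M" using M by linarith
  then have "\<exists>e\<ge>0. e \<le> M \<and> S e = c0"
    using c0 M S_0 by (intro IVT') (auto simp: S_def intro!: continuous_intros)
  then obtain e where e: "e > 0" "e \<le> M" "S e = c0"
    using S_0 c0 by (metis order_le_less)
  \<comment> \<open>\<open>G s = 0\<close> says that the constants \<open>\<alpha>\<^sub>i\<close> add up to \<open>c0\<close>, cleared of the denominator \<open>Q s\<close>.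
    Since \<open>T\<close>, \<open>p\<close> and \<open>Q\<close> may all vanish at \<open>0\<close>, the interval starts at \<open>e > 0\<close>. At \<open>M\<close>
    the bounds \<open>T \<le> (m - 1) S\<close> and \<open>m p \<le> Q\<close> give \<open>S - T p / Q \<ge> S / m \<ge> c0\<close>.\<close>
  define G where "G = (\<lambda>x. S x * Q x - T x * p x - c0 * Q x)"
  have "G e \<le> 0"
    using T_nonneg[of e] p_pos[of e] e by (simp add: G_def)
  moreover have "G M \<ge> 0"
  proof -
    have "real m * (T M * p M) \<le> T M * Q M"
      using Q_ge[of M] T_nonneg[of M] M by (metis less_imp_le mult.left_commute mult_left_mono)
    also have "\<dots> \<le> (real m - 1) * S M * Q M"
      using T_le[of M] Q_pos[of M] M by (intro mult_right_mono) auto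
    also have "\<dots> = real m * (S M * Q M) - S M * Q M" by (simp add: algebra_simps)
    also have "\<dots> \<le> real m * (S M * Q M) - real m * c0 * Q M"
      using M Q_pos[of M] by (intro diff_left_mono mult_right_mono) auto
    finally have "0 \<le> real m * G M" by (simp add: G_def algebra_simps)
    then show ?thesis using m by (simp add: zero_le_mult_iff)
  qed
  ultimately have "\<exists>s\<ge>e. s \<le> M \<and> G s = 0"
    using e by (intro IVT') (auto simp: G_def S_def Q_def T_def p_def intro!: continuous_intros)
  then obtain s where "s \<ge> e" "G s = 0" by blast
  then have s: "s > 0" using e by simp
  have bal: "T s * p s / Q s = S s - c0"
    using \<open>G s = 0\<close> Q_pos[OF s] by (simp add: G_def field_simps)
  \<comment> \<open>Nonnegativity at \<open>s\<close> itself is what keeps \<open>\<Sum>\<beta>\<^sub>i = T s / Q s\<close> from exceeding \<open>1\<close>.\<close>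
  have "p s * (T s / Q s) \<le> p s"
    using bal nonneg[of s] s by (simp add: S_def p_def mult.commute)
  then have T_Q: "T s / Q s \<le> 1"
    using mult_le_cancel_left_pos[OF p_pos[OF s], of "T s / Q s" 1] by (simp del: times_divide_eq_right)
  \<comment> \<open>\<open>\<beta> i\<close> makes the derivatives of \<open>|q\<^sub>i| x\<^sup>i\<close> and \<open>\<beta>\<^sub>i P\<close> agree at \<open>s\<close>; then \<open>\<alpha> i\<close> makes
    the values agree.\<close>
  define \<beta> where "\<beta> i = real i * \<bar>coeff q i\<bar> * s ^ i / Q s" for i
  define \<alpha> where "\<alpha> i = \<bar>coeff q i\<bar> * s ^ i - \<beta> i * p s" for i
  have sum_\<beta>: "(\<Sum>i\<le>degree q. \<beta> i) = T s / Q s"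
    by (simp add: \<beta>_def T_def poly_euler sum_divide_distrib)
  have sum_\<alpha>: "(\<Sum>i\<le>degree q. \<alpha> i) = c0"
  proof -
    have "(\<Sum>i\<le>degree q. \<alpha> i) = S s - (\<Sum>i\<le>degree q. \<beta> i) * p s"
      by (simp add: \<alpha>_def sum_subtractf sum_distrib_right S_def poly_altdef)
    then show ?thesis using bal by (simp add: sum_\<beta>)
  qed
  have piece: "SONC ([:\<alpha> i:] + monom (coeff q i) i + smult (\<beta> i) P)" for i
  proof (cases "coeff q i = 0")
    case True
    then show ?thesis by (simp add: \<alpha>_def \<beta>_def SONC_0)
  next
    case False
    have i: "i > 0" "i < m" using False q by (auto intro: gr0I)
    show ?thesis
    proof (rule SONC_piece[OF P(1,2)])
      show "\<beta> i \<ge> 0" using Q_pos[OF s] s by (simp add: \<beta>_def)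
      have "real i * p s \<le> real m * p s"
        using i p_pos[OF s] by (intro mult_right_mono) auto
      also have "\<dots> \<le> Q s"
        using s by (intro Q_ge) simp
      finally have "real i * p s \<le> Q s" .
      then have "\<bar>coeff q i\<bar> * s ^ i * (real i * p s / Q s) \<le> \<bar>coeff q i\<bar> * s ^ i * 1"
        using s Q_pos[OF s] by (intro mult_left_mono) auto
      then show "\<alpha> i \<ge> 0"
        by (simp add: \<alpha>_def \<beta>_def mult_ac)
      fix x :: real assume x: "x \<ge> 0"
      define y where "y = x / s"
      have xy: "x = s * y" "y \<ge> 0" using x s by (auto simp: y_def)
      have "real i * p s + (y ^ i - 1) * Q s \<le> real i * p x"
        unfolding xy(1) p_def Q_def
        using P i xy s by (intro poly_tangent) (auto dest: P(3))
      then have "\<bar>coeff q i\<bar> * s ^ i / Q s * (real i * p s + (y ^ i - 1) * Q s)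
          \<le> \<bar>coeff q i\<bar> * s ^ i / Q s * (real i * p x)"
        using s Q_pos[OF s] by (intro mult_left_mono) auto
      then have "\<beta> i * p s + \<bar>coeff q i\<bar> * s ^ i * (y ^ i - 1) \<le> \<beta> i * p x"
        using Q_pos[OF s] by (simp add: \<beta>_def distrib_left mult_ac)
      then show "\<alpha> i - \<bar>coeff q i\<bar> * x ^ i + \<beta> i * poly P x \<ge> 0"
        by (simp add: \<alpha>_def xy(1) power_mult_distrib algebra_simps flip: p_def)
    qed
  qed
  have "[:c0:] + q + P =
      (\<Sum>i\<le>degree q. [:\<alpha> i:] + monom (coeff q i) i + smult (\<beta> i) P) + smult (1 - T s / Q s) P"
  proof -
    have "(\<Sum>i\<le>degree q. [:\<alpha> i:]) = [:c0:]"
      unfolding sum_\<alpha>[symmetric]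
      by (rule poly_eqI) (auto simp: coeff_sum coeff_pCons split: nat.splits)
    moreover have "(\<Sum>i\<le>degree q. smult (\<beta> i) P) = smult (T s / Q s) P"
      by (simp add: smult_sum flip: sum_\<beta>)
    ultimately show ?thesis
      by (simp add: sum.distrib poly_as_sum_of_monoms smult_diff_left)
  qed
  moreover have "SONC (smult (1 - T s / Q s) P)"
    using P T_Q by (intro SONC_even_nonneg_coeffs) (auto simp: even_poly_def)
  ultimately show ?thesis
    using piece by (simp add: SONC_add SONC_sum)
qed

section \<open>The associated polynomial with negative inner terms and its first negative point\<close>

lemma hat_poly_degree_0:
  assumes "degree f = 0"
  shows "hat_poly f = [:2 * coeff f 0:]"
  using assms by (simp add: hat_poly_def monom_0)

text \<open>
  A negative leading term is counted among the inner terms, as one more term to be compensated;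
  this makes a single argument serve both signs of the leading coefficient.
\<close>
lemma hat_poly_split:
  fixes f :: "real poly"
  assumes "degree f > 0"
  defines "P \<equiv> monom (max 0 (lead_coeff f)) (degree f)"
  defines "q \<equiv> f - [:coeff f 0:] - P"
  shows "hat_poly f = [:coeff f 0:] - abs_poly q + P"
proof (rule poly_eqI)
  fix k
  have "coeff (\<Sum>i = 1..<degree f. monom \<bar>coeff f i\<bar> i) k =
      (if k \<in> {1..<degree f} then \<bar>coeff f k\<bar> else 0)"
    by (simp add: coeff_sum)
  then show "coeff (hat_poly f) k = coeff ([:coeff f 0:] - abs_poly q + P) k"
    using assms(1)
    by (auto simp: hat_poly_def q_def P_def coeff_pCons coeff_eq_0 split: nat.splits)
qed

lemma nonneg_below_first_neg:
  assumes "0 \<le> x" "ereal x < first_neg p"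
  shows "poly p x \<ge> 0"
proof (rule ccontr)
  assume "\<not> poly p x \<ge> 0"
  then have "first_neg p \<le> ereal x"
    unfolding first_neg_def using assms(1) by (intro Inf_lower) auto
  then show False using assms(2) by simp
qed

lemma first_neg_infinity_iff:
  "first_neg p = \<infinity> \<longleftrightarrow> (\<forall>x\<ge>0. poly p x \<ge> 0)"
proof
  assume "first_neg p = \<infinity>"
  then show "\<forall>x\<ge>0. poly p x \<ge> 0" by (simp add: nonneg_below_first_neg)
next
  assume "\<forall>x\<ge>0. poly p x \<ge> 0"
  then have "{x. 0 \<le> x \<and> poly p x < 0} = {}" by (auto simp: not_less)
  then show "first_neg p = \<infinity>"
    unfolding first_neg_def by (simp only: image_empty Inf_empty top_ereal_def)
qed

lemma first_neg_pos:
  assumes "poly p 0 > 0"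
  shows "first_neg p > 0"
proof -
  have "eventually (\<lambda>x. poly p x > 0) (at 0)"
    using assms poly_isCont[of 0 p] by (auto simp: isCont_def intro: order_tendstoD(1))
  then obtain d where d: "d > 0" "\<And>x. x \<noteq> 0 \<Longrightarrow> dist x 0 < d \<Longrightarrow> poly p x > 0"
    unfolding eventually_at by auto
  have "ereal d \<le> first_neg p"
    unfolding first_neg_def
  proof (rule Inf_greatest, clarify)
    fix x assume x: "0 \<le> x" "poly p x < 0"
    then have "\<not> x < d" using d(2)[of x] assms by (cases "x = 0") auto
    then show "ereal d \<le> ereal x" by simp
  qed
  then show ?thesis using d(1) by (metis ereal_less(2) less_le_trans)
qed

section \<open>Repair by a term of high degree\<close>

text \<open>
  Each monomial satisfies \<open>x\<^sup>i = r\<^sup>i (x / r)\<^sup>i\<close>, and \<open>x / r \<ge> 1\<close> allows the exponent of the second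
  factor to be raised to \<open>n\<close>. The constant in front does not depend on \<open>n\<close>.
\<close>
lemma abs_poly_growth:
  assumes "r > 0" "x \<ge> r" "n \<ge> degree p"
  shows "\<bar>poly p x\<bar> \<le> poly (abs_poly p) r * (x / r) ^ n"
proof -
  have xr: "x / r \<ge> 1" using assms by simp
  have "\<bar>poly p x\<bar> \<le> poly (abs_poly p) x"
    using abs_poly_bound[of p x] assms by simp
  also have "\<dots> = (\<Sum>i\<le>degree p. \<bar>coeff p i\<bar> * r ^ i * (x / r) ^ i)"
    using assms(1) by (simp add: poly_altdef power_divide)
  also have "\<dots> \<le> (\<Sum>i\<le>degree p. \<bar>coeff p i\<bar> * r ^ i * (x / r) ^ n)"
    using xr assms by (intro sum_mono mult_left_mono power_increasing) auto
  also have "\<dots> = poly (abs_poly p) r * (x / r) ^ n"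
    by (simp add: poly_altdef sum_distrib_right)
  finally show ?thesis .
qed

text \<open>A compact subset of the open interval has a point \<open>z\<close> of largest modulus, and it stays below
  \<open>r\<close>, so a geometric sequence with ratio \<open>|z| / r < 1\<close> dominates.\<close>
lemma uniform_limit_scaled_power:
  fixes r :: real
  assumes "r > 0" "compact K" "K \<subseteq> {-r<..<r}"
  shows "uniform_limit K (\<lambda>N x. C * (x / r) ^ (2 * (N + d))) (\<lambda>x. 0) sequentially"
proof (cases "K = {}")
  case False
  have "\<exists>z\<in>K. \<forall>x\<in>K. \<bar>x\<bar> \<le> \<bar>z\<bar>"
    by (intro continuous_attains_sup assms(2) False continuous_intros)
  then obtain z where z: "z \<in> K" "\<And>x. x \<in> K \<Longrightarrow> \<bar>x\<bar> \<le> \<bar>z\<bar>"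
    by blast
  define t where "t = \<bar>z\<bar> / r"
  have t: "t \<ge> 0" "t < 1" using z(1) assms(1) subsetD[OF assms(3) z(1)] by (auto simp: t_def abs_less_iff)
  show ?thesis
  proof (rule uniform_limit_null_comparison)
    show "\<forall>\<^sub>F N in sequentially. \<forall>x\<in>K. norm (C * (x / r) ^ (2 * (N + d))) \<le> \<bar>C\<bar> * t ^ N"
    proof (intro always_eventually allI ballI)
      fix N x assume x: "x \<in> K"
      have "\<bar>x / r\<bar> ^ (2 * (N + d)) \<le> t ^ (2 * (N + d))"
        using z(2)[OF x] assms(1) by (intro power_mono) (auto simp: t_def divide_right_mono)
      also have "\<dots> \<le> t ^ N"
        using t by (intro power_decreasing) auto
      finally show "norm (C * (x / r) ^ (2 * (N + d))) \<le> \<bar>C\<bar> * t ^ N"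
        by (simp add: abs_mult power_abs mult_left_mono)
    qed
    have "(\<lambda>N. \<bar>C\<bar> * t ^ N) \<longlonglongrightarrow> \<bar>C\<bar> * 0"
      using t by (intro tendsto_mult_left LIMSEQ_realpow_zero)
    then show "uniform_limit K (\<lambda>N x. \<bar>C\<bar> * t ^ N) (\<lambda>x. 0) sequentially"
      by (auto simp: uniform_limit_iff tendsto_iff elim: eventually_mono)
  qed
qed simp

section \<open>SONC representation and approximation\<close>

theorem theorem4p14:
  fixes f :: "real poly" and x0 :: ereal
  assumes "even (degree f)"
    and "coeff f 0 > 0"
    and "x0 = first_neg (hat_poly f)"
  shows "(x0 = \<infinity> \<longleftrightarrow> (\<forall>x. poly (hat_poly f) x \<ge> 0)) \<and>
    (x0 = \<infinity> \<longrightarrow> SONC f) \<and>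
    (x0 \<noteq> \<infinity> \<longrightarrow>
      (\<exists>p :: nat \<Rightarrow> real poly. (\<forall>N. SONC (p N)) \<and>
        (\<forall>K. compact K \<and> K \<subseteq> {x. - x0 < ereal x \<and> ereal x < x0} \<longrightarrow>
          uniform_limit K (\<lambda>N. poly (p N)) (poly f) sequentially)))"
proof (cases "degree f = 0")
  case True
  then have "f = [:coeff f 0:]" by (metis degree_0_id)
  then have "SONC f"
    using assms(2)
    by (intro SONC_even_nonneg_coeffs)
       (metis coeff_eq_0 even_poly_def odd_pos True, metis True coeff_eq_0 gr0I less_imp_le order_refl)
  moreover have "\<forall>x. poly (hat_poly f) x \<ge> 0"
    using assms(2) by (simp add: hat_poly_degree_0[OF True])
  ultimately show ?thesis
    using first_neg_infinity_iff[of "hat_poly f"] assms(3) by simp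
next
  case False
  define d where "d = degree f"
  define c0 where "c0 = coeff f 0"
  define P where "P = monom (max 0 (lead_coeff f)) d"
  define q where "q = f - [:c0:] - P"
  \<comment> \<open>\<open>m\<close> separates the inner terms from the terms that compensate them; a negative leading
    term belongs to the inner ones.\<close>
  define m where "m = (if lead_coeff f < 0 then Suc d else d)"
  have d: "d > 0" using False by (simp add: d_def)
  have hat: "hat_poly f = [:c0:] - abs_poly q + P"
    unfolding P_def q_def c0_def d_def using False by (intro hat_poly_split) simp
  have f: "f = [:c0:] + q + P" by (simp add: q_def)
  have P: "even_poly P" "\<And>k. coeff P k \<ge> 0" "\<And>k. coeff P k \<noteq> 0 \<Longrightarrow> m \<le> k"
    using assms(1) by (auto simp: P_def even_poly_def m_def d_def max_def split: if_splits)
  have q0: "coeff q 0 = 0" using d by (simp add: q_def P_def c0_def)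
  have qm: "i < m" if "coeff q i \<noteq> 0" for i
  proof (rule ccontr)
    assume "\<not> i < m"
    then have "coeff q i = 0"
      using d by (cases "i = d")
        (auto simp: q_def P_def m_def d_def c0_def coeff_pCons coeff_eq_0 split: nat.splits if_splits)
    then show False using that by simp
  qed
  have hat_abs: "poly (hat_poly f) \<bar>x\<bar> \<le> poly (hat_poly f) x" for x
    using abs_poly_bound[of "abs_poly q" x]
    by (simp add: hat poly_abs_even_poly[OF P(1)] abs_poly_def map_poly_map_poly o_def)
  have inf_iff: "x0 = \<infinity> \<longleftrightarrow> (\<forall>x. poly (hat_poly f) x \<ge> 0)"
    unfolding assms(3) first_neg_infinity_iff using hat_abs by (meson abs_ge_zero order_trans)
  moreover have "SONC f" if "x0 = \<infinity>"
  proof -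
    have "poly (hat_poly f) x \<ge> 0" for x using that inf_iff by simp
    then have "SONC ([:c0:] + q + P)"
      using assms(2) P q0 qm
      by (intro SONC_inner_terms[where m = m]) (auto simp: hat c0_def)
    then show ?thesis using f by simp
  qed
  moreover have "\<exists>p :: nat \<Rightarrow> real poly. (\<forall>N. SONC (p N)) \<and>
        (\<forall>K. compact K \<and> K \<subseteq> {x. - x0 < ereal x \<and> ereal x < x0} \<longrightarrow>
          uniform_limit K (\<lambda>N. poly (p N)) (poly f) sequentially)" if "x0 \<noteq> \<infinity>"
  proof -
    have "poly (hat_poly f) 0 > 0"
      using assms(2) d by (simp add: hat poly_0_coeff_0 q0 c0_def P_def)
    then have "x0 > 0" unfolding assms(3) by (rule first_neg_pos)
    with that obtain r where r: "x0 = ereal r" "r > 0" by (cases x0) auto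
    define C where "C = poly (abs_poly (hat_poly f)) r"
    have C: "C \<ge> 0" unfolding C_def using r by (intro abs_poly_nonneg) simp
    \<comment> \<open>The exponent \<open>2 * (N + d)\<close> is even and, as \<open>d > 0\<close>, strictly larger than \<open>d\<close>, hence
      at least \<open>m\<close> in either case.\<close>
    define R where "R N = monom (C / r ^ (2 * (N + d))) (2 * (N + d))" for N
    have R: "poly (R N) x = C * (x / r) ^ (2 * (N + d))" for N x
      by (simp add: R_def poly_monom power_divide)
    have deg_hat: "degree (hat_poly f) \<le> d"
      by (rule degree_le) (use d in \<open>auto simp: hat q_def P_def c0_def d_def coeff_eq_0 coeff_pCons split: nat.splits\<close>)
    have SONC: "SONC (f + R N)" for N
    proof -
      have "poly (hat_poly f) x + poly (R N) x \<ge> 0" if x: "x \<ge> 0" for x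
      proof (cases "x < r")
        case True
        then have "poly (hat_poly f) x \<ge> 0"
          using r assms(3) x by (intro nonneg_below_first_neg) auto
        moreover have "poly (R N) x \<ge> 0" unfolding R using C x r by simp
        ultimately show ?thesis by simp
      next
        case False
        then have "\<bar>poly (hat_poly f) x\<bar> \<le> poly (R N) x"
          unfolding R C_def using r deg_hat by (intro abs_poly_growth) auto
        then show ?thesis by linarith
      qed
      then have "SONC ([:c0:] + q + (P + R N))"
        using assms(2) P q0 qm C r d
        by (intro SONC_inner_terms[where m = m])
           (auto simp: hat c0_def R_def even_poly_def m_def add.assoc split: if_splits)
      then show ?thesis by (simp add: f add.assoc)
    qed
    have "uniform_limit K (\<lambda>N. poly (f + R N)) (poly f) sequentially"
      if K: "compact K" "K \<subseteq> {x. - x0 < ereal x \<and> ereal x < x0}" for K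
    proof -
      have "uniform_limit K (\<lambda>N x. C * (x / r) ^ (2 * (N + d))) (\<lambda>x. 0) sequentially"
        using K r by (intro uniform_limit_scaled_power) auto
      then have "uniform_limit K (\<lambda>N x. poly f x + C * (x / r) ^ (2 * (N + d)))
          (\<lambda>x. poly f x + 0) sequentially"
        by (intro uniform_limit_add uniform_limit_const)
      then show ?thesis unfolding poly_add R by simp
    qed
    with SONC show ?thesis by (intro exI[of _ "\<lambda>N. f + R N"] conjI allI impI) simp_all
  qed
  ultimately show ?thesis by simp
qed

end
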